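(* Let $(M,g,q)$ be a $3$-dimensional Riemannian manifold with circulant metric $g$ and circulant structure $q$ (as described in the context) whose curvature tensor satisfies $R(x,y,qz,qu)=R(x,y,z,u)$ for all $x,y,z,u$. If a vector $u\in T_pM$ induces a $q$-basis of $T_pM$, then $$\mu(\varphi)=\frac{1-\cos\varphi}{1+\cos\varphi}\,\mu\Big(\frac{\pi}{2}\Big),$$ where $\varphi=\angle(u,qu)$.
   Context: $(M,g,q)$ denotes a $3$-dimensional Riemannian manifold $M$ with local coordinates $(X^1,X^2,X^3)$ and coordinate basis $\{e_i\}$ of the tangent space $T_pM$, where the metric $g$ has the component matrix $$(g_{ij})=\begin{pmatrix} A & B & B \\ B & A & B \\ B & B & A \end{pmatrix},$$ with $A,B$ smooth functions of $X^1,X^2,X^3$ satisfying $A>B>0$, and $q$ is the endomorphism of the tangent spaces with coordinate matrix $$(q_i^{.j})=\begin{pmatrix}0&1&0\\0&0&1\\1&0&0\end{pmatrix},$$ so that $q^3=\mathrm{id}$ and $g(qx,qy)=g(x,y)$. With $\nabla$ the Levi-Civita connection of $g$, $R(x,y)z=\nabla_x\nabla_yz-\nabla_y\nabla_xz-\nabla_{[x,y]}z$ and $R(x,y,z,u)=g(R(x,y)z,u)$. A vector $x\in T_pM$ induces a $q$-basis if $\{x,qx,q^2x\}$ is a basis of $T_pM$; in that case $\angle(x,qx)=\angle(qx,q^2x)=\angle(x,q^2x)\in(0,\tfrac{2\pi}{3})$, and an orthogonal $q$-basis of $T_pM$ exists. The sectional curvature of the $2$-plane spanned by $x,y\in T_pM$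 is $$\mu(x,y)=\frac{R(x,y,x,y)}{g(x,x)g(y,y)-g^2(x,y)}.$$ For $x\in T_pM$ inducing a $q$-basis, $\mu(x,qx)$ depends (at the fixed point $p$) only on $\varphi=\angle(x,qx)$, and one writes $\mu(\varphi)=\mu(x,qx)$; thus $\mu(\pi/2)$ is the value of $\mu(x,qx)$ at $p$ for a vector $x$ inducing an orthogonal $q$-basis. *)

theory Defs
  imports "HOL-Analysis.Analysis"
begin

section \<open>Smooth functions and manifolds with coordinates\<close>

definition pd :: "'n::finite \<Rightarrow> (real^'n \<Rightarrow> real) \<Rightarrow> real^'n \<Rightarrow> real"
  where "pd i f p = frechet_derivative f (at p) (axis i 1)"

fun Ck_on :: "nat \<Rightarrow> (real^'n::finite) set \<Rightarrow> (real^'n \<Rightarrow> real) \<Rightarrow> bool" where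
  "Ck_on 0 S f \<longleftrightarrow> continuous_on S f"
| "Ck_on (Suc k) S f \<longleftrightarrow> (\<forall>p\<in>S. f differentiable (at p)) \<and> (\<forall>i. Ck_on k S (pd i f))"

text \<open>Only used for open \<open>S\<close>, where the derivatives at points of \<open>S\<close> depend on \<open>f\<close> on \<open>S\<close> only.\<close>

definition smooth_on :: "(real^'n::finite) set \<Rightarrow> (real^'n \<Rightarrow> real) \<Rightarrow> bool"
  where "smooth_on S f \<longleftrightarrow> (\<forall>k. Ck_on k S f)"

text \<open>A chart \<open>(V, X)\<close> consists of a coordinate neighbourhood \<open>V\<close> and its coordinates
  \<open>X = (X\<^sup>1, \<dots>, X\<^sup>n)\<close>. Tensor fields are given by their components in each chart, as functions
  of the coordinates; a tangent vector at a point of \<open>V\<close> is given by its components in the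
  coordinate basis of \<open>(V, X)\<close>.\<close>

type_synonym ('a, 'n) chart = "'a set \<times> ('a \<Rightarrow> real^'n)"

definition coord_range :: "('a, 'n::finite) chart \<Rightarrow> (real^'n) set"
  where "coord_range c = snd c ` fst c"

definition overlap :: "('a, 'n::finite) chart \<Rightarrow> ('a, 'n) chart \<Rightarrow> (real^'n) set"
  where "overlap c d = snd c ` (fst c \<inter> fst d)"

definition transition :: "('a, 'n::finite) chart \<Rightarrow> ('a, 'n) chart \<Rightarrow> real^'n \<Rightarrow> real^'n"
  where "transition c d = snd d \<circ> inv_into (fst c) (snd c)"

definition smooth_atlas :: "'a topology \<Rightarrow> ('a, 'n::finite) chart set \<Rightarrow> bool" where
  "smooth_atlas M \<A> \<longleftrightarrow>
     Hausdorff_space M \<and> second_countable M \<and>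
     (\<Union>c\<in>\<A>. fst c) = topspace M \<and>
     (\<forall>c\<in>\<A>. openin M (fst c) \<and> open (coord_range c) \<and>
        homeomorphic_map (subtopology M (fst c)) (top_of_set (coord_range c)) (snd c)) \<and>
     (\<forall>c\<in>\<A>. \<forall>d\<in>\<A>. \<forall>k. smooth_on (overlap c d) (\<lambda>x. transition c d x $ k))"

text \<open>In components: \<open>g(x, y) = g\<^sub>i\<^sub>j x\<^sup>i y\<^sup>j\<close>.\<close>

definition ip :: "real^'n^'n \<Rightarrow> real^'n \<Rightarrow> real^'n \<Rightarrow> real"
  where "ip g x y = x \<bullet> (g *v y)"

definition metric_compatible ::
    "('a, 'n::finite) chart set \<Rightarrow> (('a, 'n) chart \<Rightarrow> real^'n \<Rightarrow> real^'n^'n) \<Rightarrow> bool" where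
  "metric_compatible \<A> G \<longleftrightarrow>
     (\<forall>c\<in>\<A>. \<forall>d\<in>\<A>. \<forall>x\<in>overlap c d. \<forall>v w.
        let D = frechet_derivative (transition c d) (at x)
        in ip (G d (transition c d x)) (D v) (D w) = ip (G c x) v w)"

text \<open>An endomorphism field whose action on components is the same map \<open>q\<close> in every chart.\<close>

definition endo_compatible ::
    "('a, 'n::finite) chart set \<Rightarrow> (real^'n \<Rightarrow> real^'n) \<Rightarrow> bool" where
  "endo_compatible \<A> q \<longleftrightarrow>
     (\<forall>c\<in>\<A>. \<forall>d\<in>\<A>. \<forall>x\<in>overlap c d. \<forall>v.
        let D = frechet_derivative (transition c d) (at x) in D (q v) = q (D v))"

section \<open>Levi-Civita connection and curvature in coordinates\<close>

definition christoffel ::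
    "(real^'n \<Rightarrow> real^'n^'n) \<Rightarrow> 'n::finite \<Rightarrow> 'n \<Rightarrow> 'n \<Rightarrow> real^'n \<Rightarrow> real" where
  "christoffel G k i j p =
     (1/2) * (\<Sum>l\<in>UNIV. matrix_inv (G p) $ k $ l *
        (pd i (\<lambda>x. G x $ j $ l) p + pd j (\<lambda>x. G x $ i $ l) p - pd l (\<lambda>x. G x $ i $ j) p))"

definition nabla ::
    "(real^'n \<Rightarrow> real^'n^'n) \<Rightarrow> (real^'n \<Rightarrow> real^'n) \<Rightarrow> (real^'n \<Rightarrow> real^'n) \<Rightarrow> real^'n::finite \<Rightarrow> real^'n" where
  "nabla G X Y p =
     frechet_derivative Y (at p) (X p) +
     (\<chi> k. \<Sum>i\<in>UNIV. \<Sum>j\<in>UNIV. christoffel G k i j p * X p $ i * Y p $ j)"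

definition lie_bracket ::
    "(real^'n \<Rightarrow> real^'n) \<Rightarrow> (real^'n \<Rightarrow> real^'n) \<Rightarrow> real^'n::finite \<Rightarrow> real^'n" where
  "lie_bracket X Y p = frechet_derivative Y (at p) (X p) - frechet_derivative X (at p) (Y p)"

text \<open>\<open>nabla\<close> is torsion-free and metric, hence the Levi-Civita connection.\<close>

lemma nabla_torsion_free:
  assumes sym: "\<And>x. transpose (G x) = G x"
  shows "nabla G X Y p - nabla G Y X p = lie_bracket X Y p"
proof -
  have s: "G x $ i $ j = G x $ j $ i" for x i j
    using sym[of x] by (metis transpose_def vec_lambda_beta)
  have c: "christoffel G k i j p = christoffel G k j i p" for k i j
    unfolding christoffel_def by (simp add: s[of _ i j] add.commute)
  have "(\<Sum>i\<in>UNIV. \<Sum>j\<in>UNIV. christoffel G k i j p * Y p $ i * X p $ j) =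
        (\<Sum>i\<in>UNIV. \<Sum>j\<in>UNIV. christoffel G k i j p * X p $ i * Y p $ j)" for k
    by (subst sum.swap) (simp add: c[of k] mult.commute mult.left_commute)
  then show ?thesis
    unfolding nabla_def lie_bracket_def by simp
qed

lemma nabla_metric:
  fixes G :: "real^'n::finite \<Rightarrow> real^'n^'n"
  assumes sym: "\<And>x. transpose (G x) = G x"
    and inv: "invertible (G p)"
    and dG: "\<And>i j. (\<lambda>x. G x $ i $ j) differentiable (at p)"
    and dY: "Y differentiable (at p)" and dZ: "Z differentiable (at p)"
  shows "frechet_derivative (\<lambda>x. ip (G x) (Y x) (Z x)) (at p) (X p) =
         ip (G p) (nabla G X Y p) (Z p) + ip (G p) (Y p) (nabla G X Z p)"
proof -
  have s: "G x $ i $ j = G x $ j $ i" for x i j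
    using sym[of x] by (metis transpose_def vec_lambda_beta)
  define v where "v = X p"
  define C where "C l i j = (1/2) * (pd i (\<lambda>x. G x $ j $ l) p + pd j (\<lambda>x. G x $ i $ l) p
      - pd l (\<lambda>x. G x $ i $ j) p)" for l i j
  have CC: "C l i j + C j i l = pd i (\<lambda>x. G x $ j $ l) p" for i j l
    unfolding C_def by (simp add: s[of _ l] s[of _ j i] algebra_simps)
  have GI: "(\<Sum>k\<in>UNIV. G p $ m $ k * matrix_inv (G p) $ k $ l) = (if m = l then 1 else 0)" for m l
  proof -
    have "G p ** matrix_inv (G p) = mat 1"
      using inv unfolding invertible_def matrix_inv_def by (metis (mono_tags, lifting) someI_ex)
    then have "(G p ** matrix_inv (G p)) $ m $ l = mat 1 $ m $ l"
      by simp
    then show ?thesis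
      by (simp add: matrix_matrix_mult_def mat_def)
  qed
  have low: "(\<Sum>k\<in>UNIV. G p $ m $ k * christoffel G k i j p) = C m i j" for m i j
  proof -
    have "(\<Sum>k\<in>UNIV. G p $ m $ k * christoffel G k i j p) =
        (\<Sum>k\<in>UNIV. \<Sum>l\<in>UNIV. (G p $ m $ k * matrix_inv (G p) $ k $ l) * C l i j)"
      unfolding christoffel_def C_def by (simp add: sum_distrib_left algebra_simps)
    also have "\<dots> = (\<Sum>l\<in>UNIV. (\<Sum>k\<in>UNIV. G p $ m $ k * matrix_inv (G p) $ k $ l) * C l i j)"
      by (subst sum.swap) (simp add: sum_distrib_right)
    also have "\<dots> = C m i j"
      by (simp add: GI if_distrib[of "\<lambda>t. t * _"] cong: if_cong)
    finally show ?thesis .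
  qed
  define \<Gamma> where "\<Gamma> W = (\<chi> k. \<Sum>i\<in>UNIV. \<Sum>j\<in>UNIV. christoffel G k i j p * v $ i * W $ j)" for W
  have ipsym: "ip (G p) a b = ip (G p) b a" for a b
    unfolding ip_def using sym[of p] by (metis dot_lmul_matrix inner_commute vector_transpose_matrix)
  have ip\<Gamma>: "ip (G p) a (\<Gamma> W) = (\<Sum>l\<in>UNIV. \<Sum>i\<in>UNIV. \<Sum>j\<in>UNIV. a $ l * v $ i * W $ j * C l i j)" for a W
  proof -
    have "(G p *v \<Gamma> W) $ l = (\<Sum>i\<in>UNIV. \<Sum>j\<in>UNIV. v $ i * W $ j * C l i j)" for l
    proof -
      have "(G p *v \<Gamma> W) $ l =
          (\<Sum>k\<in>UNIV. \<Sum>i\<in>UNIV. \<Sum>j\<in>UNIV. v $ i * W $ j * (G p $ l $ k * christoffel G k i j p))"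
        unfolding \<Gamma>_def by (simp add: matrix_vector_mult_def sum_distrib_left mult_ac)
      also have "\<dots> = (\<Sum>i\<in>UNIV. \<Sum>k\<in>UNIV. \<Sum>j\<in>UNIV. v $ i * W $ j * (G p $ l $ k * christoffel G k i j p))"
        by (rule sum.swap)
      also have "\<dots> = (\<Sum>i\<in>UNIV. \<Sum>j\<in>UNIV. \<Sum>k\<in>UNIV. v $ i * W $ j * (G p $ l $ k * christoffel G k i j p))"
        by (intro sum.cong refl sum.swap)
      also have "\<dots> = (\<Sum>i\<in>UNIV. \<Sum>j\<in>UNIV. v $ i * W $ j * C l i j)"
        by (simp add: sum_distrib_left[symmetric] low)
      finally show ?thesis .
    qed
    then show ?thesis
      unfolding ip_def inner_vec_def by (simp add: sum_distrib_left mult_ac)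
  qed
  have main: "ip (G p) (\<Gamma> (Y p)) (Z p) + ip (G p) (Y p) (\<Gamma> (Z p)) =
      (\<Sum>j\<in>UNIV. \<Sum>l\<in>UNIV. (\<Sum>i\<in>UNIV. v $ i * pd i (\<lambda>x. G x $ j $ l) p) * (Y p $ j * Z p $ l))"
  proof -
    have "ip (G p) (\<Gamma> (Y p)) (Z p) =
        (\<Sum>l\<in>UNIV. \<Sum>j\<in>UNIV. \<Sum>i\<in>UNIV. Z p $ l * v $ i * Y p $ j * C l i j)"
      unfolding ipsym[of "\<Gamma> (Y p)"] ip\<Gamma> by (intro sum.cong refl sum.swap)
    also have "\<dots> = (\<Sum>j\<in>UNIV. \<Sum>l\<in>UNIV. \<Sum>i\<in>UNIV. Z p $ l * v $ i * Y p $ j * C l i j)"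
      by (rule sum.swap)
    finally have 1: "ip (G p) (\<Gamma> (Y p)) (Z p) =
        (\<Sum>j\<in>UNIV. \<Sum>l\<in>UNIV. \<Sum>i\<in>UNIV. Z p $ l * v $ i * Y p $ j * C l i j)" .
    have 2: "ip (G p) (Y p) (\<Gamma> (Z p)) =
        (\<Sum>j\<in>UNIV. \<Sum>l\<in>UNIV. \<Sum>i\<in>UNIV. Y p $ j * v $ i * Z p $ l * C j i l)"
      unfolding ip\<Gamma> by (intro sum.cong refl sum.swap)
    show ?thesis
      unfolding 1 2 CC[symmetric] sum.distrib[symmetric] sum_distrib_right
      by (intro sum.cong refl) (simp add: algebra_simps)
  qed
  have dirG: "frechet_derivative (\<lambda>x. G x $ j $ l) (at p) v =
      (\<Sum>i\<in>UNIV. v $ i * pd i (\<lambda>x. G x $ j $ l) p)" for j l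
  proof -
    have lin: "linear (frechet_derivative (\<lambda>x. G x $ j $ l) (at p))"
      by (rule linear_frechet_derivative[OF dG])
    have "frechet_derivative (\<lambda>x. G x $ j $ l) (at p) v =
        frechet_derivative (\<lambda>x. G x $ j $ l) (at p) (\<Sum>i\<in>UNIV. v $ i *\<^sub>R axis i 1)"
      by (simp add: basis_expansion[of v, unfolded scalar_mult_eq_scaleR])
    then show ?thesis
      by (simp add: linear_sum[OF lin] linear_cmul[OF lin] pd_def)
  qed
  define dY where "dY = frechet_derivative Y (at p)"
  define dZ where "dZ = frechet_derivative Z (at p)"
  define dG' where "dG' j l = frechet_derivative (\<lambda>x. G x $ j $ l) (at p)" for j l
  have hY: "((\<lambda>x. Y x $ j) has_derivative (\<lambda>h. dY h $ j)) (at p)" for j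
    using dY unfolding dY_def frechet_derivative_works
    by (rule bounded_linear.has_derivative[OF bounded_linear_vec_nth])
  have hZ: "((\<lambda>x. Z x $ j) has_derivative (\<lambda>h. dZ h $ j)) (at p)" for j
    using dZ unfolding dZ_def frechet_derivative_works
    by (rule bounded_linear.has_derivative[OF bounded_linear_vec_nth])
  have hG: "((\<lambda>x. G x $ j $ l) has_derivative dG' j l) (at p)" for j l
    using dG[of j l] unfolding dG'_def frechet_derivative_works .
  have ipe: "ip g a b = (\<Sum>j\<in>UNIV. \<Sum>l\<in>UNIV. g $ j $ l * a $ j * b $ l)" for g :: "real^'n^'n" and a b
    unfolding ip_def inner_vec_def matrix_vector_mult_def by (simp add: sum_distrib_left mult_ac)
  have "((\<lambda>x. ip (G x) (Y x) (Z x)) has_derivative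
      (\<lambda>h. \<Sum>j\<in>UNIV. \<Sum>l\<in>UNIV. G p $ j $ l * Y p $ j * dZ h $ l +
         (G p $ j $ l * dY h $ j + dG' j l h * Y p $ j) * Z p $ l)) (at p)"
    unfolding ipe by (intro has_derivative_sum has_derivative_mult hG hY hZ)
  then have "frechet_derivative (\<lambda>x. ip (G x) (Y x) (Z x)) (at p) v =
      (\<Sum>j\<in>UNIV. \<Sum>l\<in>UNIV. G p $ j $ l * Y p $ j * dZ v $ l +
         (G p $ j $ l * dY v $ j + dG' j l v * Y p $ j) * Z p $ l)"
    by (simp add: frechet_derivative_at[symmetric])
  also have "\<dots> = ip (G p) (dY v) (Z p) + ip (G p) (Y p) (dZ v) +
      (\<Sum>j\<in>UNIV. \<Sum>l\<in>UNIV. dG' j l v * (Y p $ j * Z p $ l))"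
    unfolding ipe sum.distrib[symmetric] by (intro sum.cong refl) (simp add: algebra_simps)
  also have "\<dots> = ip (G p) (dY v) (Z p) + ip (G p) (Y p) (dZ v) +
      (ip (G p) (\<Gamma> (Y p)) (Z p) + ip (G p) (Y p) (\<Gamma> (Z p)))"
    unfolding main dG'_def dirG ..
  also have "\<dots> = ip (G p) (dY v + \<Gamma> (Y p)) (Z p) + ip (G p) (Y p) (dZ v + \<Gamma> (Z p))"
    by (simp add: ip_def inner_add_left inner_add_right matrix_vector_right_distrib)
  finally show ?thesis
    unfolding nabla_def v_def dY_def dZ_def \<Gamma>_def .
qed

text \<open>\<open>R(X,Y)Z = \<nabla>\<^sub>X \<nabla>\<^sub>Y Z - \<nabla>\<^sub>Y \<nabla>\<^sub>X Z - \<nabla>\<^bsub>[X,Y]\<^esub> Z\<close> on vector fields; on tangent vectors at a point it is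
  evaluated, by tensoriality, on their extensions with constant coordinate components.\<close>

definition curv ::
    "(real^'n \<Rightarrow> real^'n^'n) \<Rightarrow> (real^'n \<Rightarrow> real^'n) \<Rightarrow> (real^'n \<Rightarrow> real^'n) \<Rightarrow> (real^'n \<Rightarrow> real^'n)
      \<Rightarrow> real^'n::finite \<Rightarrow> real^'n" where
  "curv G X Y Z p =
     nabla G X (nabla G Y Z) p - nabla G Y (nabla G X Z) p - nabla G (lie_bracket X Y) Z p"

definition riem ::
    "(real^'n \<Rightarrow> real^'n^'n) \<Rightarrow> real^'n::finite \<Rightarrow> real^'n \<Rightarrow> real^'n \<Rightarrow> real^'n \<Rightarrow> real^'n \<Rightarrow> real" where
  "riem G p x y z u = ip (G p) (curv G (\<lambda>_. x) (\<lambda>_. y) (\<lambda>_. z) p) u"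

text \<open>With these conventions the round sphere has \<open>\<mu> < 0\<close>: the sign is opposite to the usual one.\<close>

definition sect_curv ::
    "(real^'n \<Rightarrow> real^'n^'n) \<Rightarrow> real^'n::finite \<Rightarrow> real^'n \<Rightarrow> real^'n \<Rightarrow> real" where
  "sect_curv G p x y =
     riem G p x y x y / (ip (G p) x x * ip (G p) y y - (ip (G p) x y)\<^sup>2)"

definition g_angle :: "real^'n^'n \<Rightarrow> real^'n::finite \<Rightarrow> real^'n \<Rightarrow> real"
  where "g_angle g x y = arccos (ip g x y / (sqrt (ip g x x) * sqrt (ip g y y)))"

section \<open>Circulant metric and circulant structure\<close>

definition circ_metric :: "real \<Rightarrow> real \<Rightarrow> real^3^3"
  where "circ_metric a b = vector [vector [a, b, b], vector [b, a, b], vector [b, b, a]]"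

definition circ_matrix :: "real^3^3"
  where "circ_matrix = vector [vector [0, 1, 0], vector [0, 0, 1], vector [1, 0, 0]]"

text \<open>The lower index of \<open>q\<^sub>i\<^sup>j\<close> numbers the rows, so \<open>q e\<^sub>i = q\<^sub>i\<^sup>j e\<^sub>j\<close> and \<open>(q x)\<^sup>j = x\<^sup>i q\<^sub>i\<^sup>j\<close>.\<close>

definition circ_q :: "real^3 \<Rightarrow> real^3"
  where "circ_q x = x v* circ_matrix"

lemma q_vector: "circ_q (vector [a, b, c]) = vector [c, a, b]"
  by (simp add: circ_q_def circ_matrix_def vector_matrix_mult_def vec_eq_iff forall_3 sum_3)

lemma q_cubed: "circ_q (circ_q (circ_q x)) = x"
  by (simp add: circ_q_def circ_matrix_def vector_matrix_mult_def vec_eq_iff forall_3 sum_3)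

lemma q_isometry: "ip (circ_metric a b) (circ_q x) (circ_q y) = ip (circ_metric a b) x y"
  by (simp add: ip_def circ_q_def circ_matrix_def circ_metric_def vector_matrix_mult_def
      matrix_vector_mult_def inner_vec_def sum_3 algebra_simps)

lemma circ_metric_pos_def:
  assumes "0 < b" "b < a" "x \<noteq> 0"
  shows "0 < ip (circ_metric a b) x x"
proof -
  have eq: "ip (circ_metric a b) x x = (a - b) * (x \<bullet> x) + b * (x $ 1 + x $ 2 + x $ 3)\<^sup>2"
    by (simp add: ip_def circ_metric_def matrix_vector_mult_def inner_vec_def sum_3
        power2_eq_square algebra_simps)
  have "0 < (a - b) * (x \<bullet> x)"
    using assms by simp
  moreover have "0 \<le> b * (x $ 1 + x $ 2 + x $ 3)\<^sup>2"
    using assms by simp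
  ultimately show ?thesis
    unfolding eq by linarith
qed

abbreviation circ_G ::
    "(('a, 3) chart \<Rightarrow> real^3 \<Rightarrow> real) \<Rightarrow> (('a, 3) chart \<Rightarrow> real^3 \<Rightarrow> real)
      \<Rightarrow> ('a, 3) chart \<Rightarrow> real^3 \<Rightarrow> real^3^3"
  where "circ_G A B c x \<equiv> circ_metric (A c x) (B c x)"

text \<open>The atlas consists of charts in which the metric and \<open>q\<close> have the circulant component
  matrices; \<open>A\<close> and \<open>B\<close> may depend on the chart.\<close>

definition circulant_manifold ::
    "'a topology \<Rightarrow> ('a, 3) chart set \<Rightarrow> (('a, 3) chart \<Rightarrow> real^3 \<Rightarrow> real)
      \<Rightarrow> (('a, 3) chart \<Rightarrow> real^3 \<Rightarrow> real) \<Rightarrow> bool" where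
  "circulant_manifold M \<A> A B \<longleftrightarrow>
     smooth_atlas M \<A> \<and>
     (\<forall>c\<in>\<A>. smooth_on (coord_range c) (A c) \<and> smooth_on (coord_range c) (B c) \<and>
        (\<forall>x\<in>coord_range c. A c x > B c x \<and> B c x > 0)) \<and>
     metric_compatible \<A> (circ_G A B) \<and>
     endo_compatible \<A> circ_q"

definition q_basis :: "real^3 \<Rightarrow> bool" where
  "q_basis x \<longleftrightarrow>
     independent {x, circ_q x, circ_q (circ_q x)} \<and> span {x, circ_q x, circ_q (circ_q x)} = UNIV"

text \<open>\<open>\<mu>(\<phi>)\<close>: the common value of \<open>\<mu>(x, qx)\<close> over all \<open>x\<close> that induce a \<open>q\<close>-basis
  and satisfy \<open>\<angle>(x, qx) = \<phi>\<close>.\<close>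

definition mu_angle :: "(real^3 \<Rightarrow> real^3^3) \<Rightarrow> real^3 \<Rightarrow> real \<Rightarrow> real" where
  "mu_angle G p \<phi> =
     (THE m. \<exists>x. q_basis x \<and> g_angle (G p) x (circ_q x) = \<phi> \<and> m = sect_curv G p x (circ_q x))"

end

(* For fixed x, y the form R(x, y, -, -) is alternating and q-invariant, hence a multiple of the
   form (z, u) |-> det(s, z, u) with s = (1, 1, 1).  The first Bianchi identity then forces
   R(x, y, z, u) = k det(s, x, y) det(s, z, u).  Since
   g(x, x) - g(x, qx) = (A - B) det(s, x, qx), this gives
   mu(x, qx) = k / (A - B)^2 * (1 - cos phi) / (1 + cos phi), and the constant k / (A - B)^2 is the
   value at phi = pi / 2, which is attained at a vector x = (t, 1, 1). *)

theory Submission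
  imports Defs
begin

section \<open>Symmetry of second derivatives\<close>

text \<open>The mean value theorem in direction \<open>v\<close> turns the second difference into
  \<open>t\<close> times a difference of values of \<open>f' x v\<close> at two points that differ
  by \<open>t *\<^sub>R w\<close>. Expanding \<open>f' x v\<close> at \<open>p\<close> to first
  order gives t^2 F w up to o(t^2).\<close>

lemma second_difference_tendsto:
  fixes f :: "'a::real_normed_vector \<Rightarrow> real"
  assumes "open S" "p \<in> S"
    and f': "\<And>x. x \<in> S \<Longrightarrow> (f has_derivative f' x) (at x)"
    and F: "((\<lambda>x. f' x v) has_derivative F) (at p)"
  shows "((\<lambda>t. (f (p + t *\<^sub>R v + t *\<^sub>R w) - f (p + t *\<^sub>R v) - f (p + t *\<^sub>R w) + f p) / t\<^sup>2)
           \<longlongrightarrow> F w) (at_right 0)"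
proof (rule tendstoI)
  fix e :: real assume "e > 0"
  \<comment> \<open>The two intermediate points have distances from \<open>p\<close> with sum at
    most t (2 |v| + |w|), hence at most \<open>t * C\<close>; with tolerance
    \<open>e / (2 * C)\<close> the total error is at most e t / 2. The summand 1 makes
    \<open>C\<close> positive.\<close>
  define C where "C = 2 * norm v + norm w + 1"
  have "C > 0" unfolding C_def by (simp add: add_nonneg_pos)
  interpret F: bounded_linear F using F by (rule has_derivative_bounded_linear)
  obtain d0 where d0: "d0 > 0" "ball p d0 \<subseteq> S"
    using assms(1,2) open_contains_ball by blast
  obtain d1 where d1: "d1 > 0"
      "\<And>y. norm (y - p) < d1 \<Longrightarrow> norm (f' y v - f' p v - F (y - p)) \<le> e / (2 * C) * norm (y - p)"
    using F \<open>e > 0\<close> \<open>C > 0\<close> unfolding has_derivative_at_alt by (metis divide_pos_pos mult_pos_pos zero_less_numeral)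
  define d where "d = min d0 d1"
  have "d > 0" using d0 d1 d_def by simp
  have "eventually (\<lambda>t::real. t < d / C) (at_right 0)"
    using \<open>d > 0\<close> \<open>C > 0\<close> by (auto simp: eventually_at_right_field intro!: exI[of _ "d / C"])
  moreover have "eventually (\<lambda>t::real. t > 0) (at_right 0)"
    by (rule eventually_at_right_less)
  ultimately show "eventually (\<lambda>t. dist ((f (p + t *\<^sub>R v + t *\<^sub>R w) - f (p + t *\<^sub>R v) - f (p + t *\<^sub>R w) + f p) / t\<^sup>2) (F w) < e) (at_right 0)"
  proof eventually_elim
    case (elim t)
    have tC: "t * C < d" using elim \<open>C > 0\<close> by (simp add: field_simps)
    have near: "norm (s *\<^sub>R v) + norm (t *\<^sub>R w) < d" if "0 \<le> s" "s \<le> t" for s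
    proof -
      have "norm (s *\<^sub>R v) + norm (t *\<^sub>R w) \<le> t * norm v + t * norm w"
        using that elim by (simp add: mult_right_mono)
      also have "\<dots> \<le> t * C"
        using elim by (simp add: C_def flip: distrib_left)
      finally show ?thesis using tC by simp
    qed
    have inS: "p + s *\<^sub>R v + r *\<^sub>R w \<in> S" if "0 \<le> s" "s \<le> t" "r = 0 \<or> r = t" for s r
    proof -
      have "norm (s *\<^sub>R v + r *\<^sub>R w) \<le> norm (s *\<^sub>R v) + norm (t *\<^sub>R w)"
        using that norm_triangle_ineq[of "s *\<^sub>R v" "r *\<^sub>R w"] by auto
      also have "\<dots> < d0" using near[OF that(1,2)] d_def by simp
      finally have "dist p (p + s *\<^sub>R v + r *\<^sub>R w) < d0"
        by (subst dist_commute) (simp add: dist_norm add.assoc)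
      then show ?thesis using d0 by auto
    qed
    \<comment> \<open>The summand \<open>0 *\<^sub>R w\<close> gives both arguments the shape
      covered by \<open>inS\<close>.\<close>
    define g where "g s = f (p + s *\<^sub>R v + t *\<^sub>R w) - f (p + s *\<^sub>R v + 0 *\<^sub>R w)" for s
    have dg: "(g has_derivative (\<lambda>h. f' (p + s *\<^sub>R v + t *\<^sub>R w) (h *\<^sub>R v) - f' (p + s *\<^sub>R v + 0 *\<^sub>R w) (h *\<^sub>R v)))
        (at s within {0..t})" if "0 \<le> s" "s \<le> t" for s
      unfolding g_def
      by (intro has_derivative_diff has_derivative_compose[OF _ f', unfolded o_def] inS that)
         (auto intro!: derivative_eq_intros)
    \<comment> \<open>Applying the mean value theorem to the difference \<open>g\<close> yields one
      \<open>\<xi>\<close> for both terms, so that \<open>y1 - y0\<close> is exactly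
      \<open>t *\<^sub>R w\<close>.\<close>
    have "\<exists>\<xi>\<in>{0..t}. g t - g 0 =
        f' (p + \<xi> *\<^sub>R v + t *\<^sub>R w) ((t - 0) *\<^sub>R v) - f' (p + \<xi> *\<^sub>R v + 0 *\<^sub>R w) ((t - 0) *\<^sub>R v)"
      by (rule mvt_very_simple) (use elim dg in auto)
    then obtain \<xi> where \<xi>: "\<xi> \<in> {0..t}"
      "g t - g 0 = f' (p + \<xi> *\<^sub>R v + t *\<^sub>R w) ((t - 0) *\<^sub>R v) - f' (p + \<xi> *\<^sub>R v + 0 *\<^sub>R w) ((t - 0) *\<^sub>R v)"
      by blast
    define y1 where "y1 = p + \<xi> *\<^sub>R v + t *\<^sub>R w"
    define y0 where "y0 = p + \<xi> *\<^sub>R v"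
    have lin: "linear (f' y1)" "linear (f' y0)"
      using inS[of \<xi> t] inS[of \<xi> 0] \<xi>(1)
      by (auto simp: y1_def y0_def intro!: has_derivative_linear f')
    have g1: "g t - g 0 = t * (f' y1 v - f' y0 v)"
      using \<xi>(2) lin by (simp add: y1_def y0_def linear_cmul right_diff_distrib)
    have n1: "norm (y1 - p) \<le> t * (norm v + norm w)"
      unfolding y1_def using norm_triangle_ineq[of "\<xi> *\<^sub>R v" "t *\<^sub>R w"] \<xi>(1) elim
      by (simp add: distrib_left add.assoc) (smt (verit) mult_right_mono norm_ge_zero)
    have n0: "norm (y0 - p) \<le> t * norm v"
      unfolding y0_def using \<xi>(1) by (simp add: mult_right_mono)
    have "t * (norm v + norm w) \<le> t * C" "t * norm v \<le> t * C"
      using elim by (auto intro!: mult_left_mono simp: C_def)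
    with n1 n0 tC have "norm (y1 - p) < d1" "norm (y0 - p) < d1"
      by (simp_all add: d_def)
    note b = d1(2)[OF this(1)] d1(2)[OF this(2)]
    have "F (y1 - p) - F (y0 - p) = t * F w"
      by (simp add: y1_def y0_def F.add F.scale)
    then have "\<bar>(f' y1 v - f' y0 v) - t * F w\<bar> \<le> e / (2 * C) * norm (y1 - p) + e / (2 * C) * norm (y0 - p)"
      using b by (simp add: abs_le_iff)
    also have "\<dots> \<le> e / (2 * C) * (t * (norm v + norm w)) + e / (2 * C) * (t * norm v)"
      using n1 n0 \<open>e > 0\<close> \<open>C > 0\<close> by (intro add_mono mult_left_mono) auto
    also have "\<dots> \<le> e / (2 * C) * (t * C)"
      using elim \<open>e > 0\<close> \<open>C > 0\<close> unfolding distrib_left[symmetric] by (intro mult_left_mono) (auto simp: C_def algebra_simps)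
    also have "\<dots> < e * t" using elim \<open>e > 0\<close> \<open>C > 0\<close> by simp
    finally have *: "\<bar>(f' y1 v - f' y0 v) - t * F w\<bar> < e * t" .
    have \<Delta>: "f (p + t *\<^sub>R v + t *\<^sub>R w) - f (p + t *\<^sub>R v) - f (p + t *\<^sub>R w) + f p = g t - g 0"
      by (simp add: g_def)
    have "(g t - g 0) / t\<^sup>2 - F w = ((f' y1 v - f' y0 v) - t * F w) / t"
      using elim by (simp add: g1 field_simps power2_eq_square)
    then show ?case
      unfolding \<Delta> dist_real_def using * elim by (simp add: abs_divide pos_divide_less_eq)
  qed
qed

text \<open>The second difference is symmetric in \<open>v\<close> and \<open>w\<close>, so its
  limits \<open>F w\<close> and \<open>H v\<close> coincide.\<close>

lemma second_derivative_symmetric: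
  fixes f :: "'a::real_normed_vector \<Rightarrow> real"
  assumes "open S" "p \<in> S"
    and "\<And>x. x \<in> S \<Longrightarrow> (f has_derivative f' x) (at x)"
    and "((\<lambda>x. f' x v) has_derivative F) (at p)"
    and "((\<lambda>x. f' x w) has_derivative H) (at p)"
  shows "F w = H v"
  using second_difference_tendsto[OF assms(1-4), of w] second_difference_tendsto[OF assms(1-3,5), of v]
  by (intro tendsto_unique[OF trivial_limit_at_right_real]) (simp_all add: algebra_simps)

section \<open>Curvature-like forms invariant under \<open>circ_q\<close>\<close>

text \<open>The determinant of \<open>(1, 1, 1)\<close>, \<open>x\<close> and \<open>y\<close>.\<close>

definition cross_sum :: "real^3 \<Rightarrow> real^3 \<Rightarrow> real" where
  "cross_sum x y = x$1 * y$2 - x$2 * y$1 + (x$2 * y$3 - x$3 * y$2) + (x$3 * y$1 - x$1 * y$3)"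

text \<open>An alternating form on a three-dimensional space is determined by its values on (e1,
  e2), (e2, e3), (e3, e1). The assumption \<open>c\<close> makes these equal, and
  \<open>cross_sum\<close> takes the value 1 on each pair.\<close>

lemma alternating_circulant_form:
  fixes T :: "real^3 \<Rightarrow> real^3 \<Rightarrow> real"
  assumes T: "bilinear T" and alt: "\<And>x. T x x = 0"
    and c: "T (axis 2 1) (axis 3 1) = T (axis 1 1) (axis 2 1)"
      "T (axis 3 1) (axis 1 1) = T (axis 1 1) (axis 2 1)"
  shows "T x y = T (axis 1 1) (axis 2 1) * cross_sum x y"
proof -
  have anti: "T x y = - T y x" for x y
    using alt[of "x + y"] alt[of x] alt[of y] by (simp add: bilinear_ladd[OF T] bilinear_radd[OF T])
  have e: "x = x$1 *\<^sub>R axis 1 1 + x$2 *\<^sub>R axis 2 1 + x$3 *\<^sub>R axis 3 1" for x :: "real^3"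
    by (simp add: vec_eq_iff forall_3 axis_def)
  show ?thesis
    by (subst e[of x], subst e[of y])
       (simp add: bilinear_ladd[OF T] bilinear_radd[OF T] bilinear_lmul[OF T] bilinear_rmul[OF T] alt c
        anti[of "axis 2 1" "axis 1 1"] anti[of "axis 3 1" "axis 2 1"] anti[of "axis 1 1" "axis 3 1"]
        cross_sum_def algebra_simps)
qed

text \<open>Addition in the index type \<open>3\<close> is modulo 3, so the pair (3, 1) falls under
  \<open>j = i + 1\<close>.\<close>

lemma cross_sum_axis:
  "cross_sum (axis i 1) (axis j 1) = (if i = j then 0 else if j = i + 1 then 1 else - 1)"
  using exhaust_3[of i] exhaust_3[of j] by (auto simp: cross_sum_def axis_def)

lemma circ_q_axis: "circ_q (axis 1 1) = axis 2 1" "circ_q (axis 2 1) = axis 3 1" "circ_q (axis 3 1) = axis 1 1"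
  by (simp_all add: circ_q_def circ_matrix_def vector_matrix_mult_def vec_eq_iff forall_3 sum_3 axis_def)

lemma circ_q_nth: "circ_q x $ 1 = x $ 3" "circ_q x $ 2 = x $ 1" "circ_q x $ 3 = x $ 2"
  by (simp_all add: circ_q_def circ_matrix_def vector_matrix_mult_def sum_3)

lemma q_invariant_curvature_form:
  fixes R :: "real^3 \<Rightarrow> real^3 \<Rightarrow> real^3 \<Rightarrow> real^3 \<Rightarrow> real"
  assumes lin12: "\<And>z u. bilinear (\<lambda>x y. R x y z u)" and lin34: "\<And>x y. bilinear (R x y)"
    and alt12: "\<And>x z u. R x x z u = 0" and alt34: "\<And>x y z. R x y z z = 0"
    and bianchi: "\<And>x y z u. R x y z u + R y z x u + R z x y u = 0"
    and q: "\<And>x y z u. R x y (circ_q z) (circ_q u) = R x y z u"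
  obtains k where "\<And>x y z u. R x y z u = k * cross_sum x y * cross_sum z u"
proof
  define \<omega> where "\<omega> x y = R x y (axis 1 1) (axis 2 1)" for x y
  have R: "R x y z u = \<omega> x y * cross_sum z u" for x y z u
    unfolding \<omega>_def using q[of x y "axis 1 1" "axis 2 1"] q[of x y "axis 2 1" "axis 3 1"]
    by (intro alternating_circulant_form lin34 alt34) (simp_all add: circ_q_axis)
  \<comment> \<open>On (e1, e2, e3) the Bianchi identity reads \<omega>(e1, e2) - \<omega>(e3, e1) =
    0 for u = e1 and \<omega>(e2, e3) - \<omega>(e1, e2) = 0 for u = e2.\<close>
  have "\<omega> (axis 2 1) (axis 3 1) = \<omega> (axis 1 1) (axis 2 1)"
       "\<omega> (axis 3 1) (axis 1 1) = \<omega> (axis 1 1) (axis 2 1)"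
    using bianchi[of "axis 1 1" "axis 2 1" "axis 3 1" "axis 1 1"]
      bianchi[of "axis 1 1" "axis 2 1" "axis 3 1" "axis 2 1"]
    by (simp_all add: R cross_sum_axis)
  then have "\<omega> x y = \<omega> (axis 1 1) (axis 2 1) * cross_sum x y" for x y
    by (intro alternating_circulant_form) (simp_all add: \<omega>_def lin12 alt12)
  then show "R x y z u = \<omega> (axis 1 1) (axis 2 1) * cross_sum x y * cross_sum z u" for x y z u
    by (metis R)
qed

section \<open>Angles and sectional curvature for the circulant metric\<close>

text \<open>The metric matrix is (a - b) I + b J, where J has all entries 1.\<close>

lemma ip_circ_metric:
  "ip (circ_metric a b) x y = (a - b) * (x \<bullet> y) + b * (x$1 + x$2 + x$3) * (y$1 + y$2 + y$3)"
  by (simp add: ip_def circ_metric_def matrix_vector_mult_def inner_vec_def sum_3 algebra_simps)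

text \<open>\<open>x\<close> and \<open>circ_q x\<close> have the same coordinate sum, so the
  \<open>b\<close> part cancels; the Euclidean difference that is left equals
  \<open>cross_sum x (circ_q x)\<close>. This links the curvature numerator to the angle.\<close>

lemma ip_circ_metric_diff:
  "ip (circ_metric a b) x x - ip (circ_metric a b) x (circ_q x) = (a - b) * cross_sum x (circ_q x)"
  by (simp add: ip_circ_metric circ_q_nth inner_vec_def sum_3 cross_sum_def algebra_simps)

lemma cross_sum_circ_q_eq:
  "cross_sum x (circ_q x) = ((x$1 - x$2)\<^sup>2 + (x$2 - x$3)\<^sup>2 + (x$3 - x$1)\<^sup>2) / 2"
  by (simp add: circ_q_nth cross_sum_def power2_eq_square algebra_simps)

text \<open>By its expression as a sum of squares, \<open>cross_sum x (circ_q x)\<close> can fail to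
  be positive only if all coordinates agree; then \<open>circ_q x = x\<close>, and a single vector
  would span the space.\<close>

lemma q_basis_cross_sum_pos:
  assumes "q_basis x" shows "cross_sum x (circ_q x) > 0"
proof (rule ccontr)
  assume "\<not> ?thesis"
  then have "(x$1 - x$2)\<^sup>2 + (x$2 - x$3)\<^sup>2 + (x$3 - x$1)\<^sup>2 \<le> 0"
    by (simp add: cross_sum_circ_q_eq)
  then have "(x$1 - x$2)\<^sup>2 = 0" "(x$2 - x$3)\<^sup>2 = 0"
    using zero_le_power2[of "x$1 - x$2"] zero_le_power2[of "x$2 - x$3"] zero_le_power2[of "x$3 - x$1"]
    by linarith+
  then have "circ_q x = x"
    by (simp add: vec_eq_iff forall_3 circ_q_nth)
  then have "span {x} = UNIV" "independent {x}"
    using assms by (simp_all add: q_basis_def)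
  then have "dim (UNIV :: (real^3) set) = 1"
    by (metis dim_span_eq_card_independent card.empty card.insert empty_iff finite.emptyI One_nat_def)
  then show False by simp
qed

text \<open>The Euclidean part of the sum is half of |x|^2 plus half the square of the coordinate
  sum. Positivity keeps cos \<phi> away from -1.\<close>

lemma ip_circ_metric_add_pos:
  assumes "0 < b" "b < a" "x \<noteq> 0"
  shows "0 < ip (circ_metric a b) x x + ip (circ_metric a b) x (circ_q x)"
proof -
  have "ip (circ_metric a b) x x + ip (circ_metric a b) x (circ_q x) =
      (a - b) * ((x \<bullet> x + (x$1 + x$2 + x$3)\<^sup>2) / 2) + 2 * b * (x$1 + x$2 + x$3)\<^sup>2"
    by (simp add: ip_circ_metric circ_q_nth inner_vec_def sum_3 power2_eq_square field_simps)
  moreover have "(a - b) * ((x \<bullet> x + (x$1 + x$2 + x$3)\<^sup>2) / 2) > 0"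
    using assms by (intro mult_pos_pos divide_pos_pos add_pos_nonneg) auto
  moreover have "2 * b * (x$1 + x$2 + x$3)\<^sup>2 \<ge> 0"
    using assms by simp
  ultimately show ?thesis by linarith
qed

text \<open>Since \<open>circ_q\<close> is an isometry, the product of the two norms is g(x, x). The
  two inequalities place the quotient in [-1, 1], where \<open>cos\<close> inverts
  \<open>arccos\<close>.\<close>

lemma cos_g_angle_circ_q:
  assumes "0 < b" "b < a" "x \<noteq> 0"
  shows "cos (g_angle (circ_metric a b) x (circ_q x)) =
    ip (circ_metric a b) x (circ_q x) / ip (circ_metric a b) x x"
proof -
  let ?g = "ip (circ_metric a b)"
  have pos: "?g x x > 0" using circ_metric_pos_def[OF assms] .
  have "cross_sum x (circ_q x) \<ge> 0" by (simp add: cross_sum_circ_q_eq)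
  then have "?g x (circ_q x) \<le> ?g x x"
    using ip_circ_metric_diff[of a b x] assms by (smt (verit) mult_nonneg_nonneg)
  moreover have "- ?g x x \<le> ?g x (circ_q x)"
    using ip_circ_metric_add_pos[OF assms] by simp
  ultimately show ?thesis
    using pos by (simp add: g_angle_def q_isometry field_simps)
qed

lemma q_basis_nonzero: "q_basis x \<Longrightarrow> x \<noteq> 0"
  using q_basis_cross_sum_pos[of x] by (auto simp: cross_sum_def)

text \<open>With D = (g - h) / (a - b), the numerator k D^2 shares one factor g - h with the
  denominator (g - h)(g + h); the remaining quotient (g - h) / (g + h) is expressed by cos \<phi> =
  h / g.\<close>

lemma sect_curv_circ_q:
  assumes "0 < b" "b < a" "q_basis x" "G r = circ_metric a b"
    and R: "\<And>x y z u. riem G r x y z u = k * cross_sum x y * cross_sum z u"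
    and \<phi>: "\<phi> = g_angle (G r) x (circ_q x)"
  shows "sect_curv G r x (circ_q x) = (1 - cos \<phi>) / (1 + cos \<phi>) * (k / (a - b)\<^sup>2)"
proof -
  have nz: "x \<noteq> 0" by (rule q_basis_nonzero) fact
  define g where "g = ip (circ_metric a b) x x"
  define h where "h = ip (circ_metric a b) x (circ_q x)"
  define D where "D = cross_sum x (circ_q x)"
  have D: "D = (g - h) / (a - b)"
    using ip_circ_metric_diff[of a b x] assms by (simp add: g_def h_def D_def)
  have pos: "g > 0" "g + h > 0" "D > 0"
    using circ_metric_pos_def[OF assms(1,2) nz] ip_circ_metric_add_pos[OF assms(1,2) nz]
      q_basis_cross_sum_pos[OF assms(3)] by (simp_all add: g_def h_def D_def)
  then have "g - h > 0" using D assms by (simp add: zero_less_divide_iff)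
  have "cos \<phi> = h / g"
    using cos_g_angle_circ_q[OF assms(1,2) nz] by (simp add: \<phi> assms(4) g_def h_def)
  then have "1 - cos \<phi> = (g - h) / g" "1 + cos \<phi> = (g + h) / g"
    using pos by (simp_all add: diff_divide_distrib add_divide_distrib)
  then have c: "(1 - cos \<phi>) / (1 + cos \<phi>) = (g - h) / (g + h)"
    using pos by simp
  have "sect_curv G r x (circ_q x) = k * D * D / (g * g - h\<^sup>2)"
    unfolding sect_curv_def R by (simp add: assms(4) q_isometry g_def h_def D_def)
  also have "g * g - h\<^sup>2 = (g - h) * (g + h)" by (simp add: algebra_simps power2_eq_square)
  also have "k * D * D / ((g - h) * (g + h)) = (g - h) / (g + h) * (k / (a - b)\<^sup>2)"
    using \<open>g - h > 0\<close> pos assms unfolding D by (simp add: divide_simps power2_eq_square)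
  finally show ?thesis unfolding c .
qed

section \<open>Existence of an orthogonal q-basis\<close>

lemma orthogonal_q_basis_exists:
  assumes "0 < b" "b < a"
  obtains x where "q_basis x" "ip (circ_metric a b) x (circ_q x) = 0"
proof -
  \<comment> \<open>Orthogonality of (t, 1, 1) and (1, t, 1) is the quadratic equation b t^2 + 2 (a
    + b) t + (a + 3 b) = 0; a quarter of its discriminant is (a - b)(a + 2 b).\<close>
  define t where "t = (sqrt ((a - b) * (a + 2 * b)) - (a + b)) / b"
  have "b * t + (a + b) = sqrt ((a - b) * (a + 2 * b))"
    using assms by (simp add: t_def)
  then have "(b * t + (a + b))\<^sup>2 = (a - b) * (a + 2 * b)"
    using assms by simp
  then have "b * (b * t\<^sup>2 + 2 * (a + b) * t + (a + 3 * b)) = 0"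
    by (simp add: power2_eq_square algebra_simps)
  then have t: "b * t\<^sup>2 + 2 * (a + b) * t + (a + 3 * b) = 0"
    using assms by simp
  \<comment> \<open>The circulant matrix of (t, 1, 1) has determinant (t - 1)^2 (t + 2). At its
    zeros 1 and -2 the quadratic takes the nonzero values 3 (a + 2 b) and -3 (a - b).\<close>
  have t1: "t - 1 \<noteq> 0"
  proof
    assume "t - 1 = 0"
    then have "t = 1" by simp
    then show False using t assms by simp
  qed
  have t2: "t + 2 \<noteq> 0"
  proof
    assume "t + 2 = 0"
    then have "t = -2" by simp
    then show False using t assms by simp
  qed
  define x :: "real^3" where "x = vector [t, 1, 1]"
  have q: "circ_q x = vector [1, t, 1]" "circ_q (circ_q x) = vector [1, 1, t]"
    by (simp_all add: x_def q_vector)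
  let ?B = "{x, circ_q x, circ_q (circ_q x)}"
  have "y \<in> span ?B" for y
  proof -
    \<comment> \<open>A combination with coefficients c1, c2, c3 has i-th coordinate s + (t - 1) ci,
      where s = c1 + c2 + c3; adding the coordinates determines s, and then each ci.\<close>
    define s where "s = (y$1 + y$2 + y$3) / (t + 2)"
    define c where "c = (1 / (t - 1)) *\<^sub>R (y - s *\<^sub>R vector [1, 1, 1])"
    have s: "y$1 + y$2 + y$3 = s * (t + 2)" using t2 by (simp add: s_def)
    have c: "y$1 = s + (t - 1) * c$1" "y$2 = s + (t - 1) * c$2" "y$3 = s + (t - 1) * c$3"
      using t1 by (simp_all add: c_def)
    have "(t - 1) * (c$1 + c$2 + c$3) = (t - 1) * s"
      using s unfolding c by (simp add: algebra_simps)
    then have "s = c$1 + c$2 + c$3" using t1 by simp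
    then have "y = c$1 *\<^sub>R x + c$2 *\<^sub>R circ_q x + c$3 *\<^sub>R circ_q (circ_q x)"
      unfolding q(2) unfolding q(1) unfolding x_def by (simp add: vec_eq_iff forall_3 c algebra_simps)
    also have "\<dots> \<in> span ?B"
      by (intro span_add span_scale span_base) auto
    finally show ?thesis .
  qed
  then have sp: "span ?B = UNIV" by auto
  moreover have "independent ?B"
    by (rule card_le_dim_spanning[of _ UNIV]) (use sp in \<open>auto simp: card_insert_if\<close>)
  ultimately have "q_basis x" by (simp add: q_basis_def)
  moreover have "ip (circ_metric a b) x (circ_q x) = 0"
    using t unfolding q(1) ip_circ_metric unfolding x_def
    by (simp add: inner_vec_def sum_3 power2_eq_square algebra_simps)
  ultimately show ?thesis using that by blast
qed

section \<open>The connection on constant fields and linearity of the curvature\<close>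

lemma nabla_const:
  "nabla G (\<lambda>_. x) (\<lambda>_. y) p = (\<chi> k. \<Sum>i\<in>UNIV. \<Sum>j\<in>UNIV. christoffel G k i j p * x $ i * y $ j)"
  by (simp add: nabla_def)

lemma bilinear_nabla_const: "bilinear (\<lambda>x y. nabla G (\<lambda>_. x) (\<lambda>_. y) p)"
  unfolding bilinear_def nabla_const
  by (auto intro!: linearI simp: vec_eq_iff algebra_simps sum.distrib sum_distrib_left)

lemma differentiable_vec_lambda:
  fixes f :: "'b::real_normed_vector \<Rightarrow> real^'n::finite"
  assumes "\<And>k. (\<lambda>x. f x $ k) differentiable (at a within S)"
  shows "f differentiable (at a within S)"
proof -
  have "(\<lambda>x. \<Sum>k\<in>UNIV. f x $ k *\<^sub>R axis k (1::real)) differentiable (at a within S)"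
    by (intro differentiable_sum ballI differentiable_scaleR assms differentiable_const) auto
  then show ?thesis
    unfolding basis_expansion[where 'a = real, unfolded scalar_mult_eq_scaleR] .
qed

lemma nabla_const_differentiable:
  assumes "\<And>k i j. christoffel G k i j differentiable (at p)"
  shows "(\<lambda>r. nabla G (\<lambda>_. x) (\<lambda>_. y) r) differentiable (at p)"
  by (rule differentiable_vec_lambda) (auto simp: nabla_const intro!: derivative_intros assms)

lemma linear_nabla_left:
  assumes "W differentiable (at p)"
  shows "linear (\<lambda>x. nabla G (\<lambda>_. x) W p)"
proof -
  have "linear (frechet_derivative W (at p))"
    by (rule linear_frechet_derivative) fact
  then show ?thesis
    unfolding nabla_def
    by (auto intro!: linearI simp: vec_eq_iff algebra_simps sum.distrib sum_distrib_left linear_add linear_cmul)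
qed

lemma nabla_add:
  assumes "U differentiable (at p)" "W differentiable (at p)"
  shows "nabla G X (\<lambda>r. U r + W r) p = nabla G X U p + nabla G X W p"
proof -
  have "frechet_derivative (\<lambda>r. U r + W r) (at p) =
      (\<lambda>h. frechet_derivative U (at p) h + frechet_derivative W (at p) h)"
    using assms[unfolded frechet_derivative_works]
    by (intro frechet_derivative_at[symmetric] has_derivative_add)
  then show ?thesis
    by (simp add: nabla_def vec_eq_iff algebra_simps sum.distrib)
qed

lemma nabla_scaleR:
  assumes "W differentiable (at p)"
  shows "nabla G X (\<lambda>r. c *\<^sub>R W r) p = c *\<^sub>R nabla G X W p"
proof -
  have "frechet_derivative (\<lambda>r. c *\<^sub>R W r) (at p) = (\<lambda>h. c *\<^sub>R frechet_derivative W (at p) h)"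
    using assms[unfolded frechet_derivative_works]
    by (intro frechet_derivative_at[symmetric] has_derivative_scaleR_right)
  then show ?thesis
    by (simp add: nabla_def vec_eq_iff algebra_simps sum_distrib_left)
qed

text \<open>Constant fields commute, so the bracket term is a derivative in direction 0.\<close>

lemma curv_const:
  "curv G (\<lambda>_. x) (\<lambda>_. y) (\<lambda>_. z) p =
     nabla G (\<lambda>_. x) (\<lambda>r. nabla G (\<lambda>_. y) (\<lambda>_. z) r) p - nabla G (\<lambda>_. y) (\<lambda>r. nabla G (\<lambda>_. x) (\<lambda>_. z) r) p"
proof -
  have "nabla G (lie_bracket (\<lambda>_. x) (\<lambda>_. y)) (\<lambda>_. z) p = 0"
    by (simp add: nabla_def lie_bracket_def vec_eq_iff)
  then show ?thesis by (simp add: curv_def)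
qed

lemma linear_ip_left: "linear (\<lambda>x. ip g x y)" and linear_ip_right: "linear (\<lambda>y. ip g x y)"
  by (auto intro!: linearI simp: ip_def inner_add_left inner_add_right matrix_vector_right_distrib
      matrix_vector_mult_scaleR)

text \<open>Linearity of \<open>frechet_derivative\<close> is available only at points of
  differentiability. The assumption makes covariant derivatives of constant fields differentiable at
  \<open>p\<close>, so that a second covariant derivative is linear in its arguments.\<close>

locale differentiable_connection =
  fixes G :: "real^'n::finite \<Rightarrow> real^'n^'n" and p :: "real^'n"
  assumes christoffel_differentiable: "\<And>k i j. christoffel G k i j differentiable (at p)"
begin

lemma linear_curv:
  "linear (\<lambda>x. curv G (\<lambda>_. x) (\<lambda>_. y) (\<lambda>_. z) p)"
  "linear (\<lambda>y. curv G (\<lambda>_. x) (\<lambda>_. y) (\<lambda>_. z) p)"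
  "linear (\<lambda>z. curv G (\<lambda>_. x) (\<lambda>_. y) (\<lambda>_. z) p)"
proof -
  note d = nabla_const_differentiable[of G p, OF christoffel_differentiable]
  note b = bilinear_nabla_const[of G]
  \<comment> \<open>The outer direction is covered by \<open>linear_nabla_left\<close>;
    \<open>l\<close> and \<open>r\<close> treat the two arguments of the inner derivative.\<close>
  have l: "linear (\<lambda>y. nabla G (\<lambda>_. x) (\<lambda>r. nabla G (\<lambda>_. y) (\<lambda>_. z) r) p)" for x z
    by (rule linearI)
       (simp_all add: bilinear_ladd[OF b] bilinear_lmul[OF b] nabla_add nabla_scaleR d)
  have r: "linear (\<lambda>z. nabla G (\<lambda>_. x) (\<lambda>r. nabla G (\<lambda>_. y) (\<lambda>_. z) r) p)" for x y
    by (rule linearI)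
       (simp_all add: bilinear_radd[OF b] bilinear_rmul[OF b] nabla_add nabla_scaleR d)
  show "linear (\<lambda>x. curv G (\<lambda>_. x) (\<lambda>_. y) (\<lambda>_. z) p)"
    unfolding curv_const by (intro linear_compose_sub linear_nabla_left d l)
  show "linear (\<lambda>y. curv G (\<lambda>_. x) (\<lambda>_. y) (\<lambda>_. z) p)"
    unfolding curv_const by (intro linear_compose_sub linear_nabla_left d l)
  show "linear (\<lambda>z. curv G (\<lambda>_. x) (\<lambda>_. y) (\<lambda>_. z) p)"
    unfolding curv_const by (intro linear_compose_sub r)
qed

lemma bilinear_riem:
  "bilinear (\<lambda>x y. riem G p x y z u)" "bilinear (riem G p x y)"
  unfolding bilinear_def riem_def
  using linear_compose[OF linear_curv(1) linear_ip_left] linear_compose[OF linear_curv(2) linear_ip_left]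
    linear_compose[OF linear_curv(3) linear_ip_left]
  by (auto simp: o_def linear_ip_right)

end

section \<open>Symmetries of the curvature tensor\<close>

lemma riem_same: "riem G p x x z u = 0"
  by (simp add: riem_def curv_const ip_def)

text \<open>Absence of torsion makes \<open>nabla\<close> symmetric on constant fields, and the six
  second derivatives in the cyclic sum cancel in pairs.\<close>

lemma riem_bianchi:
  assumes "\<And>x. transpose (G x) = G x"
  shows "riem G p x y z u + riem G p y z x u + riem G p z x y u = 0"
proof -
  have c: "nabla G (\<lambda>_. x) (\<lambda>_. y) = nabla G (\<lambda>_. y) (\<lambda>_. x)" for x y
    using nabla_torsion_free[of G "\<lambda>_. x" "\<lambda>_. y", OF assms] by (simp add: fun_eq_iff lie_bracket_def)
  have "curv G (\<lambda>_. x) (\<lambda>_. y) (\<lambda>_. z) p + curv G (\<lambda>_. y) (\<lambda>_. z) (\<lambda>_. x) p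
      + curv G (\<lambda>_. z) (\<lambda>_. x) (\<lambda>_. y) p = 0"
    unfolding curv_const eta_contract_eq by (simp add: c[of z x] c[of z y] c[of y x])
  then show ?thesis
    by (simp add: riem_def flip: linear_add[OF linear_ip_left]) (simp add: ip_def)
qed

lemma ip_commute: "transpose g = g \<Longrightarrow> ip g x y = ip g y x"
  unfolding ip_def by (metis dot_lmul_matrix inner_commute vector_transpose_matrix)

lemma differentiable_ip:
  fixes G :: "'a::real_normed_vector \<Rightarrow> real^'n^'n"
  assumes "\<And>i j. (\<lambda>x. G x $ i $ j) differentiable (at p)"
    and "Y differentiable (at p)" "Z differentiable (at p)"
  shows "(\<lambda>x. ip (G x) (Y x) (Z x)) differentiable (at p)"
proof -
  have c: "(\<lambda>x. W x $ i) differentiable (at p)" if "W differentiable (at p)" for W :: "'a \<Rightarrow> real^'n" and i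
    using that unfolding differentiable_def
    by (blast intro: bounded_linear.has_derivative[OF bounded_linear_vec_nth])
  show ?thesis
    unfolding ip_def inner_vec_def matrix_vector_mult_def
    by (auto intro!: derivative_intros c assms)
qed

text \<open>The Hessian of \<open>g(Z, Z)\<close> is symmetric; by metricity its antisymmetric part is \<open>2 g(R(X, Y) Z, Z)\<close>.\<close>

lemma riem_antisym:
  fixes G :: "real^'n::finite \<Rightarrow> real^'n^'n"
  assumes "open S" "p \<in> S" and sym: "\<And>x. transpose (G x) = G x"
    and inv: "\<And>r. r \<in> S \<Longrightarrow> invertible (G r)"
    and dG: "\<And>r i j. r \<in> S \<Longrightarrow> (\<lambda>x. G x $ i $ j) differentiable (at r)"
    and "\<And>k i j. christoffel G k i j differentiable (at p)"
  shows "riem G p x y z z = 0"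
proof -
  define f where "f r = ip (G r) z z" for r
  define N where "N v r = nabla G (\<lambda>_. v) (\<lambda>_. z) r" for v r
  have dN: "N v differentiable (at p)" for v
    using nabla_const_differentiable[of G p v z] assms(6) by (simp add: N_def[abs_def])
  have df: "(f has_derivative frechet_derivative f (at r)) (at r)" if "r \<in> S" for r
    unfolding f_def[abs_def] using that
    by (intro frechet_derivative_works[THEN iffD1] differentiable_ip dG) auto
  have Df: "frechet_derivative f (at r) v = 2 * ip (G r) (N v r) z" if "r \<in> S" for r v
    using nabla_metric[OF sym inv[OF that] dG[OF that], where X = "\<lambda>_. v" and Y = "\<lambda>_. z" and Z = "\<lambda>_. z"]
    by (simp add: f_def[abs_def] N_def ip_commute[OF sym])
  define H where "H v = frechet_derivative (\<lambda>r. ip (G r) (N v r) z) (at p)" for v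
  have dH: "(\<lambda>r. ip (G r) (N v r) z) differentiable (at p)" for v
    by (intro differentiable_ip dG dN differentiable_const assms)
  \<comment> \<open>The formula \<open>Df\<close> holds on the open set \<open>S\<close> around
    \<open>p\<close>, which suffices to transfer the derivative at \<open>p\<close>.\<close>
  have "((\<lambda>r. frechet_derivative f (at r) v) has_derivative (\<lambda>h. 2 * H v h)) (at p)" for v
  proof (rule has_derivative_transform_within_open[OF _ assms(1,2)])
    show "((\<lambda>r. 2 * ip (G r) (N v r) z) has_derivative (\<lambda>h. 2 * H v h)) (at p)"
      using dH[of v] unfolding frechet_derivative_works H_def by (rule has_derivative_mult_right)
  qed (simp add: Df)
  from second_derivative_symmetric[OF assms(1,2) df this this] have "H y x = H x y"
    by simp
  \<comment> \<open>Metricity is applied a second time. The last term is symmetric in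
    \<open>v\<close> and \<open>w\<close>, so it drops out of \<open>H y x = H x y\<close>.\<close>
  moreover have "H v w = ip (G p) (nabla G (\<lambda>_. w) (N v) p) z + ip (G p) (N v p) (N w p)" for v w
    using nabla_metric[OF sym inv[OF assms(2)] dG[OF assms(2)] dN, where X = "\<lambda>_. w" and Z = "\<lambda>_. z"]
    by (simp add: H_def N_def)
  ultimately have "ip (G p) (nabla G (\<lambda>_. x) (N y) p) z = ip (G p) (nabla G (\<lambda>_. y) (N x) p) z"
    using ip_commute[OF sym, of p "N x p" "N y p"] by simp
  then show ?thesis
    by (simp add: riem_def curv_const N_def[abs_def] linear_diff[OF linear_ip_left])
qed

section \<open>Regularity of the circulant connection\<close>

lemma circ_metric_nth: "circ_metric a b $ i $ j = (if i = j then a else b)"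
  using exhaust_3[of i] exhaust_3[of j] by (auto simp: circ_metric_def)

lemma transpose_circ_metric: "transpose (circ_metric a b) = circ_metric a b"
  by (simp add: vec_eq_iff transpose_def circ_metric_nth)

lemma circ_metric_inverse:
  assumes "0 < b" "b < a"
  shows "invertible (circ_metric a b)"
    and "matrix_inv (circ_metric a b) =
      (1 / ((a - b) * (a + 2 * b))) *\<^sub>R circ_metric (a + b) (- b)"
proof -
  let ?M = "circ_metric a b" and ?N = "(1 / ((a - b) * (a + 2 * b))) *\<^sub>R circ_metric (a + b) (- b)"
  have nz: "(a - b) * (a + 2 * b) \<noteq> 0" using assms by simp
  have "circ_metric a b ** circ_metric (a + b) (- b) = ((a - b) * (a + 2 * b)) *\<^sub>R mat 1"
    "circ_metric (a + b) (- b) ** circ_metric a b = ((a - b) * (a + 2 * b)) *\<^sub>R mat 1"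
    by (simp_all add: vec_eq_iff forall_3 matrix_matrix_mult_def circ_metric_nth mat_def sum_3 algebra_simps)
  then have MN: "?M ** ?N = mat 1" "?N ** ?M = mat 1"
    using nz by (simp_all add: matrix_scalar_ac flip: scalar_matrix_assoc)
  then show inv: "invertible ?M" unfolding invertible_def by blast
  \<comment> \<open>\<open>matrix_inv\<close> is defined by choice; it is identified with
    \<open>?N\<close> through uniqueness of inverses.\<close>
  have "matrix_inv ?M ** ?M = mat 1"
    using inv unfolding invertible_def matrix_inv_def by (metis (mono_tags, lifting) someI_ex)
  then have "?N = matrix_inv ?M ** ?M ** ?N" by simp
  also have "\<dots> = matrix_inv ?M"
    unfolding matrix_mul_assoc[symmetric] MN(1) by simp
  finally show "matrix_inv ?M = ?N" ..
qed

lemma smooth_on_differentiable: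
  assumes "smooth_on S f" "r \<in> S"
  shows "f differentiable (at r)" "pd i f differentiable (at r)"
proof -
  have "Ck_on (Suc (Suc 0)) S f" using assms(1) unfolding smooth_on_def by blast
  then show "f differentiable (at r)" "pd i f differentiable (at r)"
    using assms(2) by auto
qed

text \<open>The symbols combine first partial derivatives of \<open>A\<close> and \<open>B\<close>
  with entries of the inverse metric, which are rational in \<open>A\<close> and \<open>B\<close>
  with nonvanishing denominator on \<open>S\<close>.\<close>

lemma circ_christoffel_differentiable:
  assumes "open S" "p \<in> S" "smooth_on S A" "smooth_on S B"
    and AB: "\<And>r. r \<in> S \<Longrightarrow> 0 < B r \<and> B r < A r"
  shows "christoffel (\<lambda>r. circ_metric (A r) (B r)) k i j differentiable (at p)"
proof -
  note d = smooth_on_differentiable[OF assms(3,2)] smooth_on_differentiable[OF assms(4,2)]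
  let ?G = "\<lambda>r. circ_metric (A r) (B r)"
  have e: "pd i (\<lambda>r. ?G r $ j $ l) differentiable (at p)" for i j l
    by (cases "j = l") (simp_all add: circ_metric_nth d)
  have m: "(\<lambda>r. matrix_inv (?G r) $ k $ l) differentiable (at p)" for k l
  proof -
    define c where "c r = 1 / ((A r - B r) * (A r + 2 * B r))" for r
    have "(A p - B p) * (A p + 2 * B p) \<noteq> 0" using AB[OF assms(2)] by simp
    then have dc: "c differentiable (at p)"
      unfolding c_def[abs_def] by (intro derivative_intros d)
    have "(\<lambda>r. c r * (if k = l then A r + B r else - B r)) differentiable (at p)"
      by (cases "k = l") (auto intro!: derivative_intros d dc)
    then obtain D where "((\<lambda>r. c r * (if k = l then A r + B r else - B r)) has_derivative D) (at p)"
      unfolding differentiable_def by blast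
    \<comment> \<open>The inverse formula is known only where 0 < B < A, that is, on
      \<open>S\<close>.\<close>
    from has_derivative_transform_within_open[OF this assms(1,2)]
    have "((\<lambda>r. matrix_inv (?G r) $ k $ l) has_derivative D) (at p)"
      by (simp add: circ_metric_inverse(2) AB c_def circ_metric_nth)
    then show ?thesis unfolding differentiable_def by blast
  qed
  show ?thesis
    unfolding christoffel_def[abs_def] by (auto intro!: derivative_intros e m)
qed

section \<open>Curvature as a function of the angle\<close>

text \<open>\<open>mu_angle\<close> is a definite description: the witness \<open>x\<close> supplies
  existence, the last assumption uniqueness.\<close>

lemma mu_angle_eqI:
  assumes "q_basis x" "g_angle (G r) x (circ_q x) = \<phi>"
    and "\<And>y. q_basis y \<Longrightarrow> g_angle (G r) y (circ_q y) = \<phi> \<Longrightarrow> sect_curv G r y (circ_q y) = m"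
  shows "mu_angle G r \<phi> = m"
  unfolding mu_angle_def
proof (rule the_equality)
  show "\<exists>x. q_basis x \<and> g_angle (G r) x (circ_q x) = \<phi> \<and> m = sect_curv G r x (circ_q x)"
    using assms(3)[OF assms(1,2)] assms(1,2) by auto
qed (use assms(3) in blast)

theorem corollary4p3:
  fixes M :: "'a topology"
    and \<A> :: "('a, 3) chart set"
    and A B :: "('a, 3) chart \<Rightarrow> real^3 \<Rightarrow> real"
    and V :: "'a set" and X :: "'a \<Rightarrow> real^3" and p :: 'a and u :: "real^3"
  assumes "circulant_manifold M \<A> A B"
    and "\<forall>c\<in>\<A>. \<forall>r\<in>fst c. \<forall>x y z w.
           riem (circ_G A B c) (snd c r) x y (circ_q z) (circ_q w) =
           riem (circ_G A B c) (snd c r) x y z w"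
    and "(V, X) \<in> \<A>" and "p \<in> V"
    and "q_basis u"
  shows "let G = circ_G A B (V, X);
             \<phi> = g_angle (G (X p)) u (circ_q u)
         in mu_angle G (X p) \<phi> =
            (1 - cos \<phi>) / (1 + cos \<phi>) * mu_angle G (X p) (pi / 2)"
proof -
  define S where "S = coord_range (V, X)"
  define G where "G = circ_G A B (V, X)"
  define P where "P = X p"
  define a b where "a = A (V, X) P" and "b = B (V, X) P"
  have S: "open S" "P \<in> S"
    using assms(1,3,4)
    by (auto simp: S_def P_def coord_range_def circulant_manifold_def smooth_atlas_def)
  have AB: "smooth_on S (A (V, X))" "smooth_on S (B (V, X))"
    "\<And>r. r \<in> S \<Longrightarrow> 0 < B (V, X) r \<and> B (V, X) r < A (V, X) r"
    using assms(1,3) unfolding circulant_manifold_def S_def by auto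
  have ab: "0 < b" "b < a" using AB(3)[OF S(2)] by (simp_all add: a_def b_def)
  have GP: "G P = circ_metric a b" by (simp add: G_def a_def b_def)
  have dG: "(\<lambda>x. G x $ i $ j) differentiable (at r)" if "r \<in> S" for r i j
    using smooth_on_differentiable(1)[OF AB(1) that] smooth_on_differentiable(1)[OF AB(2) that]
    by (cases "i = j") (simp_all add: G_def circ_metric_nth)
  have dC: "christoffel G k i j differentiable (at P)" for k i j
    unfolding G_def by (rule circ_christoffel_differentiable[OF S AB])
  have sym: "transpose (G r) = G r" for r
    by (simp add: G_def transpose_circ_metric)
  have inv: "invertible (G r)" if "r \<in> S" for r
    using circ_metric_inverse(1) AB(3)[OF that] by (simp add: G_def)
  interpret differentiable_connection G P
    by unfold_locales (rule dC)
  have "riem G P x y (circ_q z) (circ_q w) = riem G P x y z w" for x y z w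
    using assms(2-4) unfolding G_def P_def by fastforce
  then obtain k where k: "\<And>x y z w. riem G P x y z w = k * cross_sum x y * cross_sum z w"
    using q_invariant_curvature_form[of "riem G P", OF bilinear_riem riem_same
        riem_antisym[of S P G, OF S sym inv dG dC] riem_bianchi[of G, OF sym]] by blast
  note sect = sect_curv_circ_q[of b a _ G P k, OF ab _ GP k]
  \<comment> \<open>The value in \<open>sect\<close> depends on the vector only through its angle,
    so the description in \<open>mu_angle\<close> is well defined at every angle attained by a
    q-basis.\<close>
  have mu: "mu_angle G P (g_angle (G P) x (circ_q x)) =
      (1 - cos (g_angle (G P) x (circ_q x))) / (1 + cos (g_angle (G P) x (circ_q x))) * (k / (a - b)\<^sup>2)"
    if "q_basis x" for x
    using that by (intro mu_angle_eqI[OF that refl] sect) auto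
  obtain y where y: "q_basis y" "ip (circ_metric a b) y (circ_q y) = 0"
    using orthogonal_q_basis_exists[OF ab] .
  have "g_angle (G P) y (circ_q y) = pi / 2"
    by (simp add: g_angle_def GP y(2))
  \<comment> \<open>At pi / 2 the cosine vanishes and the angular factor is 1, which identifies the
    constant.\<close>
  with mu[OF y(1)] have "mu_angle G P (pi / 2) = k / (a - b)\<^sup>2"
    by simp
  with mu[OF assms(5)] show ?thesis
    by (simp add: Let_def G_def P_def)
qed

end
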